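(* Let $h,k\in\mathbb{C}$ with $k\ne0$. For every $n\ge0$, the $n$-th moment $\mathcal{V}[x^n]$ of the polynomials $P_n(h,k,x)$ equals $$\sum_{p=1}^{\lfloor\frac{n+2}{2}\rfloor}\frac{n!}{p!\,(n-2p+2)!\,(p-1)!}\,(-h)^{n-2p+2}\,k^{p-1}.$$
   Context: Let $P_n(h,k,x)\in\mathbb{C}[x]$ be defined by $P_{-1}=0$, $P_0=1$, $P_n(h,k,x)=(x+h)P_{n-1}(h,k,x)-kP_{n-2}(h,k,x)$ for $n\ge1$. Since $k\neq0$, by Favard's theorem there is a unique linear functional $\mathcal{V}:\mathbb{C}[x]\to\mathbb{C}$ with $\mathcal{V}[1]=1$ and $\mathcal{V}[P_mP_n]=0$ for $m\ne n$. Convention: $0^0=1$. *)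

theory Defs
  imports Complex_Main "HOL-Computational_Algebra.Polynomial"
begin

(* Indexing by nat, the convention P_{-1} = 0 turns the recurrence at n = 1 into P_1 = (x + h) P_0. *)
fun P :: "complex \<Rightarrow> complex \<Rightarrow> nat \<Rightarrow> complex poly" where
  "P h k 0 = 1"
| "P h k (Suc 0) = [:h, 1:] * P h k 0"
| "P h k (Suc (Suc n)) = [:h, 1:] * P h k (Suc n) - smult k (P h k n)"

definition normalized_orthogonality_functional ::
    "(nat \<Rightarrow> complex poly) \<Rightarrow> (complex poly \<Rightarrow> complex) \<Rightarrow> bool" where
  "normalized_orthogonality_functional Q V \<longleftrightarrow>
     Vector_Spaces.linear smult (*) V \<and> V 1 = 1 \<and>
     (\<forall>m n. m \<noteq> n \<longrightarrow> V (Q m * Q n) = 0)"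

(* For k \<noteq> 0, Favard's theorem says that exactly one functional satisfies the description. *)
definition moment_functional :: "complex \<Rightarrow> complex \<Rightarrow> complex poly \<Rightarrow> complex" where
  "moment_functional h k = (THE V. normalized_orthogonality_functional (P h k) V)"

end

theory Submission
  imports Defs
begin

text \<open>
  Multiplication by \<open>x\<close> acts on the basis \<open>P_m\<close> by a tridiagonal rule,
  \<open>x P_m = P_(m+1) - h P_m + k P_(m-1)\<close>.  Hence the coefficient \<open>path_weight h k n m\<close> of \<open>P_m\<close> in
  \<open>x^n\<close> is the total weight of the lattice paths with \<open>n\<close> steps that run from height \<open>0\<close> to height
  \<open>m\<close> and never go below \<open>0\<close>, where an up step has weight \<open>1\<close>, a level step \<open>-h\<close> and a down step
  \<open>k\<close>.

  A normalised orthogonality functional kills every \<open>P_m\<close> with \<open>m > 0\<close>, so it must be the extraction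
  of the coefficient of \<open>P_0\<close>, and its moments are the weights of the paths that return to height
  \<open>0\<close> (\<open>orthogonality_functional_moment\<close>).  Conversely, the extraction of the coefficient of \<open>P_0\<close>
  is such a functional: by the recurrence of the \<open>P_m\<close>, applying it to \<open>P_m q\<close> gives
  \<open>k^m\<close> times the coefficient of \<open>P_m\<close> in \<open>q\<close> (\<open>basis_coeff_zero_mult_P\<close>).  This settles both halves
  of the definite description that defines \<open>moment_functional\<close>.

  It remains to count the paths.  By the ballot theorem there are
  \<open>(m + 1) n! / (p! (m + p + 1)! (n - m - 2 p)!)\<close> of them with exactly \<open>p\<close> down steps; removing the
  last step shows that these numbers satisfy the recurrence of the path weights
  (\<open>ballot_term_Suc\<close>).  The theorem is the case \<open>m = 0\<close>, with its summation index
  one larger than the number of down steps.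
\<close>

section \<open>Weighted lattice paths\<close>

primrec path_weight :: "'a::comm_ring_1 \<Rightarrow> 'a \<Rightarrow> nat \<Rightarrow> nat \<Rightarrow> 'a" where
  "path_weight h k 0 m = (if m = 0 then 1 else 0)"
| "path_weight h k (Suc n) m =
     (if m = 0 then 0 else path_weight h k n (m - 1)) - h * path_weight h k n m
       + k * path_weight h k n (Suc m)"

text \<open>The total weight of the paths with exactly \<open>p\<close> down steps, hence \<open>m + p\<close> up steps.  The guard
  says that the number of level steps is not negative; it lets sums over \<open>p\<close> run over
  any sufficiently long range.\<close>
definition ballot_term :: "'a::field_char_0 \<Rightarrow> 'a \<Rightarrow> nat \<Rightarrow> nat \<Rightarrow> nat \<Rightarrow> 'a" where
  "ballot_term h k n m p =
     (if m + 2 * p \<le> n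
      then of_nat (m + 1) * fact n / (fact p * fact (m + p + 1) * fact (n - m - 2 * p))
             * (- h) ^ (n - m - 2 * p) * k ^ p
      else 0)"

text \<open>With \<open>l\<close> level steps, the three summands remove a last step that goes up, is level, or goes
  down.  After division by the common factor the claim is
  \<open>(m + 1) (m + 2 p + l) = m (m + p + 1) + (m + 1) l + (m + 2) p\<close>.\<close>
lemma ballot_number_rec:
  fixes m p l n :: nat
  assumes "m + 2 * p + l = Suc n"
  shows "(of_nat (m + 1) * fact (Suc n) / (fact p * fact (m + p + 1) * fact l) :: 'a::field_char_0) =
    (if m = 0 then 0 else of_nat m * fact n / (fact p * fact (m + p) * fact l))
    + (if l = 0 then 0 else of_nat (m + 1) * fact n / (fact p * fact (m + p + 1) * fact (l - 1)))
    + (if p = 0 then 0 else of_nat (m + 2) * fact n / (fact (p - 1) * fact (m + p + 1) * fact l))"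
proof -
  let ?D = "fact p * fact (m + p + 1) * fact l :: 'a"
  have up: "(if m = 0 then 0 else of_nat m * fact n / (fact p * fact (m + p) * fact l) :: 'a)
      = of_nat (m * (m + p + 1)) * fact n / ?D"
  proof -
    have *: "?D = of_nat (m + p + 1) * (fact p * fact (m + p) * fact l)"
      by simp
    show ?thesis
      unfolding * of_nat_mult using of_nat_neq_0[where ?'a = 'a, of "m + p"]
      by (simp del: of_nat_Suc of_nat_add)
  qed
  have level: "(if l = 0 then 0
      else of_nat (m + 1) * fact n / (fact p * fact (m + p + 1) * fact (l - 1)) :: 'a)
      = of_nat ((m + 1) * l) * fact n / ?D"
  proof (cases l)
    case (Suc l')
    have *: "?D = of_nat l * (fact p * fact (m + p + 1) * fact (l - 1))"
      using Suc by simp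
    show ?thesis
      unfolding * of_nat_mult using Suc by (simp del: of_nat_Suc of_nat_add fact_Suc)
  qed simp
  have down: "(if p = 0 then 0
      else of_nat (m + 2) * fact n / (fact (p - 1) * fact (m + p + 1) * fact l) :: 'a)
      = of_nat ((m + 2) * p) * fact n / ?D"
  proof (cases p)
    case (Suc p')
    have *: "?D = of_nat p * (fact (p - 1) * fact (m + p + 1) * fact l)"
      using Suc by simp
    show ?thesis
      unfolding * of_nat_mult using Suc by (simp del: of_nat_Suc of_nat_add fact_Suc)
  qed simp
  have "(m + 1) * Suc n = m * (m + p + 1) + (m + 1) * l + (m + 2) * p"
    unfolding assms[symmetric] by (simp add: algebra_simps)
  then have "(of_nat (m + 1) * of_nat (Suc n) :: 'a)
      = of_nat (m * (m + p + 1)) + of_nat ((m + 1) * l) + of_nat ((m + 2) * p)"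
    by (simp only: of_nat_mult[symmetric] of_nat_add[symmetric])
  moreover have "fact (Suc n) = (of_nat (Suc n) * fact n :: 'a)"
    by (rule fact_Suc)
  ultimately have "of_nat (m + 1) * fact (Suc n) / ?D
      = (of_nat (m * (m + p + 1)) + of_nat ((m + 1) * l) + of_nat ((m + 2) * p)) * fact n / ?D"
    by (simp only: mult.assoc[symmetric])
  then show ?thesis
    unfolding up level down by (simp only: add_divide_distrib distrib_right)
qed

lemma ballot_term_Suc:
  "ballot_term h k (Suc n) m p =
     (if m = 0 then 0 else ballot_term h k n (m - 1) p) - h * ballot_term h k n m p
       + (if p = 0 then 0 else k * ballot_term h k n (Suc m) (p - 1))"
proof (cases "m + 2 * p \<le> Suc n")
  case False
  then show ?thesis
    by (auto simp: ballot_term_def)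
next
  case True
  define l where "l = Suc n - m - 2 * p"
  have l: "m + 2 * p + l = Suc n"
    using True by (simp add: l_def)
  have lhs: "ballot_term h k (Suc n) m p =
      of_nat (m + 1) * fact (Suc n) / (fact p * fact (m + p + 1) * fact l) * ((- h) ^ l * k ^ p)"
    using True by (simp add: ballot_term_def l_def del: fact_Suc)
  have up: "(if m = 0 then 0 else ballot_term h k n (m - 1) p) =
      (if m = 0 then 0 else of_nat m * fact n / (fact p * fact (m + p) * fact l))
        * ((- h) ^ l * k ^ p)"
  proof (cases m)
    case (Suc m')
    have "m - 1 + 2 * p \<le> n" "n - (m - 1) - 2 * p = l"
      using l Suc by simp_all
    then show ?thesis
      using Suc by (simp add: ballot_term_def del: of_nat_Suc fact_Suc)
  qed simp
  have level: "- h * ballot_term h k n m p =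
      (if l = 0 then 0 else of_nat (m + 1) * fact n / (fact p * fact (m + p + 1) * fact (l - 1)))
        * ((- h) ^ l * k ^ p)"
  proof (cases l)
    case 0
    then show ?thesis
      using l by (simp add: ballot_term_def)
  next
    case (Suc l')
    have "m + 2 * p \<le> n" "n - m - 2 * p = l'"
      using l Suc by simp_all
    then show ?thesis
      using Suc by (simp add: ballot_term_def del: of_nat_Suc fact_Suc)
  qed
  have down: "(if p = 0 then 0 else k * ballot_term h k n (Suc m) (p - 1)) =
      (if p = 0 then 0 else of_nat (m + 2) * fact n / (fact (p - 1) * fact (m + p + 1) * fact l))
        * ((- h) ^ l * k ^ p)"
  proof (cases p)
    case (Suc p')
    have "Suc m + 2 * p' \<le> n" "n - Suc m - 2 * p' = l"
      using l Suc by simp_all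
    then show ?thesis
      using Suc by (simp add: ballot_term_def del: of_nat_Suc fact_Suc)
  qed simp
  have "ballot_term h k (Suc n) m p =
      (if m = 0 then 0 else ballot_term h k n (m - 1) p) + - h * ballot_term h k n m p
       + (if p = 0 then 0 else k * ballot_term h k n (Suc m) (p - 1))"
    unfolding lhs up level down ballot_number_rec[OF l] by (simp only: distrib_right)
  then show ?thesis
    by simp
qed

text \<open>The path weights and the sums of ballot terms obey the same recurrence.  The
  summation bound is arbitrary because the down step shifts \<open>p\<close> by one, which shortens the range.\<close>
lemma path_weight_eq_sum_ballot_term:
  assumes "n \<le> N"
  shows "path_weight h k n m = (\<Sum>p\<le>N. ballot_term h k n m p)"
  using assms
proof (induction n arbitrary: m N)
  case 0
  have "(\<Sum>p\<le>N. ballot_term h k 0 m p) = (\<Sum>p\<le>N. if p = 0 then (if m = 0 then 1 else 0) else 0)"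
    by (rule sum.cong) (auto simp: ballot_term_def)
  then show ?case
    by simp
next
  case (Suc n)
  then obtain M where N: "N = Suc M" and M: "n \<le> M"
    by (cases N) auto
  have IH: "path_weight h k n j = (\<Sum>p\<le>N. ballot_term h k n j p)" for j
    using Suc by simp
  have "(\<Sum>p\<le>N. ballot_term h k (Suc n) m p) =
      (\<Sum>p\<le>N. if m = 0 then 0 else ballot_term h k n (m - 1) p)
      - h * (\<Sum>p\<le>N. ballot_term h k n m p)
      + (\<Sum>p\<le>N. if p = 0 then 0 else k * ballot_term h k n (Suc m) (p - 1))"
    unfolding ballot_term_Suc by (simp add: sum.distrib sum_subtractf sum_distrib_left)
  also have "(\<Sum>p\<le>N. if m = 0 then 0 else ballot_term h k n (m - 1) p)
      = (if m = 0 then 0 else path_weight h k n (m - 1))"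
    using IH by simp
  also have "(\<Sum>p\<le>N. ballot_term h k n m p) = path_weight h k n m"
    using IH by simp
  also have "(\<Sum>p\<le>N. if p = 0 then 0 else k * ballot_term h k n (Suc m) (p - 1))
      = k * path_weight h k n (Suc m)"
    unfolding N sum.atMost_Suc_shift using Suc.IH[OF M] by (simp add: sum_distrib_left)
  finally show ?case
    by simp
qed

lemma path_weight_zero_closed_form:
  fixes h k :: "'a::field_char_0"
  shows "path_weight h k n 0 =
    (\<Sum>p = 1..(n + 2) div 2.
       fact n / (fact p * fact (n + 2 - 2 * p) * fact (p - 1)) *
       (- h) ^ (n + 2 - 2 * p) * k ^ (p - 1))"
proof -
  have "path_weight h k n 0 = (\<Sum>p\<le>n. ballot_term h k n 0 p)"
    by (rule path_weight_eq_sum_ballot_term) simp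
  also have "\<dots> = (\<Sum>p\<le>n div 2. ballot_term h k n 0 p)"
    by (rule sum.mono_neutral_right) (auto simp: ballot_term_def)
  also have "\<dots> = (\<Sum>p = Suc 0..Suc (n div 2). ballot_term h k n 0 (p - 1))"
    unfolding sum.shift_bounds_cl_Suc_ivl by (simp add: atLeast0AtMost)
  also have "\<dots> = (\<Sum>p = 1..(n + 2) div 2.
       fact n / (fact p * fact (n + 2 - 2 * p) * fact (p - 1)) *
       (- h) ^ (n + 2 - 2 * p) * k ^ (p - 1))"
  proof (rule sum.cong)
    fix p assume p: "p \<in> {1..(n + 2) div 2}"
    then have "2 * (p - 1) \<le> n" "n - 2 * (p - 1) = n + 2 - 2 * p" "Suc (p - 1) = p"
      by auto
    then show "ballot_term h k n 0 (p - 1) =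
       fact n / (fact p * fact (n + 2 - 2 * p) * fact (p - 1)) *
       (- h) ^ (n + 2 - 2 * p) * k ^ (p - 1)"
      by (simp add: ballot_term_def mult_ac del: fact_Suc)
  qed simp
  finally show ?thesis .
qed

section \<open>Coefficients with respect to the orthogonal basis\<close>

text \<open>The coefficient of \<open>P_m\<close> in \<open>q\<close>, obtained by expanding every power of \<open>x\<close> in \<open>q\<close>.\<close>
definition basis_coeff :: "complex \<Rightarrow> complex \<Rightarrow> nat \<Rightarrow> complex poly \<Rightarrow> complex" where
  "basis_coeff h k m q = (\<Sum>i\<le>degree q. coeff q i * path_weight h k i m)"

lemma basis_coeff_eq_sum:
  assumes "degree q \<le> N"
  shows "basis_coeff h k m q = (\<Sum>i\<le>N. coeff q i * path_weight h k i m)"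
  unfolding basis_coeff_def
  by (rule sum.mono_neutral_left) (use assms in \<open>auto simp: coeff_eq_0\<close>)

lemma basis_coeff_add:
  "basis_coeff h k m (p + q) = basis_coeff h k m p + basis_coeff h k m q"
proof -
  let ?N = "max (degree p) (degree q)"
  have "degree (p + q) \<le> ?N" "degree p \<le> ?N" "degree q \<le> ?N"
    by (simp_all add: degree_add_le_max)
  then show ?thesis
    by (simp add: basis_coeff_eq_sum[where N = ?N] distrib_right sum.distrib)
qed

lemma basis_coeff_smult: "basis_coeff h k m (smult c q) = c * basis_coeff h k m q"
  by (simp add: basis_coeff_eq_sum[where N = "degree q"] degree_smult_le sum_distrib_left mult.assoc)

lemma basis_coeff_diff:
  "basis_coeff h k m (p - q) = basis_coeff h k m p - basis_coeff h k m q"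
  using basis_coeff_add[of h k m "p - q" q] by simp

lemma basis_coeff_1: "basis_coeff h k m 1 = (if m = 0 then 1 else 0)"
  by (simp add: basis_coeff_def)

lemma basis_coeff_pCons_0:
  "basis_coeff h k m (pCons 0 q) =
     (if m = 0 then 0 else basis_coeff h k (m - 1) q) - h * basis_coeff h k m q
       + k * basis_coeff h k (Suc m) q"
proof -
  have "basis_coeff h k m (pCons 0 q) = (\<Sum>i\<le>degree q. coeff q i * path_weight h k (Suc i) m)"
    unfolding basis_coeff_eq_sum[OF degree_pCons_le] sum.atMost_Suc_shift by simp
  also have "\<dots> = (if m = 0 then 0 else basis_coeff h k (m - 1) q) - h * basis_coeff h k m q
       + k * basis_coeff h k (Suc m) q"
    by (simp add: basis_coeff_def algebra_simps sum.distrib sum_subtractf sum_distrib_left)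
  finally show ?thesis .
qed

text \<open>The level steps cancel against the shift by \<open>h\<close>.\<close>
lemma basis_coeff_linear_factor:
  "basis_coeff h k m ([:h, 1:] * q) =
     (if m = 0 then 0 else basis_coeff h k (m - 1) q) + k * basis_coeff h k (Suc m) q"
proof -
  have "[:h, 1:] * q = smult h q + pCons 0 q"
    by simp
  then show ?thesis
    by (simp only: basis_coeff_add basis_coeff_smult basis_coeff_pCons_0) simp
qed

lemma basis_coeff_P: "basis_coeff h k m (P h k n) = (if m = n then 1 else 0)"
proof (induction h k n arbitrary: m rule: P.induct)
  case (3 h k n)
  have "basis_coeff h k m (P h k (Suc (Suc n))) =
      (if m = 0 then 0 else basis_coeff h k (m - 1) (P h k (Suc n)))
        + k * basis_coeff h k (Suc m) (P h k (Suc n)) - k * basis_coeff h k m (P h k n)"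
    by (simp only: P.simps basis_coeff_diff basis_coeff_smult basis_coeff_linear_factor)
  also have "\<dots> = (if m = Suc (Suc n) then 1 else 0)"
    unfolding 3 by auto
  finally show ?case .
qed (simp_all only: P.simps basis_coeff_linear_factor basis_coeff_1, auto)

text \<open>Multiplication by \<open>x + h\<close> lowers or raises the index of a basis coefficient by one, and
  the recurrence of the polynomials cancels the lowered one.  Together with
  \<open>basis_coeff_P\<close> this gives orthogonality.\<close>
lemma basis_coeff_zero_mult_P: "basis_coeff h k 0 (P h k m * q) = k ^ m * basis_coeff h k m q"
proof (induction h k m arbitrary: q rule: P.induct)
  case (1 h k)
  then show ?case
    by simp
next
  case (2 h k)
  then show ?case
    by (simp only: P.simps mult_1_right basis_coeff_linear_factor) simp
next
  case (3 h k m)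
  have "P h k (Suc (Suc m)) * q = P h k (Suc m) * ([:h, 1:] * q) - smult k (P h k m * q)"
    by (simp only: P.simps left_diff_distrib mult_smult_left mult.assoc mult.left_commute)
  then show ?case
    by (simp only: basis_coeff_diff basis_coeff_smult 3 basis_coeff_linear_factor)
      (simp add: algebra_simps)
qed

section \<open>The orthogonality functional\<close>

lemma linear_functional_poly_iff:
  fixes V :: "'a::field poly \<Rightarrow> 'a"
  shows "Vector_Spaces.linear smult (*) V \<longleftrightarrow>
     (\<forall>p q. V (p + q) = V p + V q) \<and> (\<forall>c p. V (smult c p) = c * V p)"
proof -
  have "vector_space (smult :: 'a \<Rightarrow> 'a poly \<Rightarrow> 'a poly)"
    by unfold_locales (simp_all add: smult_add_left smult_add_right)
  moreover have "vector_space ((*) :: 'a \<Rightarrow> 'a \<Rightarrow> 'a)"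
    by unfold_locales (simp_all add: algebra_simps)
  ultimately show ?thesis
    by (auto simp: Vector_Spaces.linear_iff)
qed

lemma basis_coeff_zero_is_orthogonality_functional:
  "normalized_orthogonality_functional (P h k) (basis_coeff h k 0)"
  unfolding normalized_orthogonality_functional_def linear_functional_poly_iff
  by (simp add: basis_coeff_add basis_coeff_smult basis_coeff_1 basis_coeff_zero_mult_P basis_coeff_P)

text \<open>Multiplication of \<open>P_m\<close> by \<open>x\<close> trades the power \<open>x^n\<close> for neighbouring indices
  of \<open>P\<close>.  The factor \<open>k^m\<close>, which is the value of \<open>V\<close> on the square of \<open>P_m\<close>, makes the resulting
  recurrence agree with that of the path weights although the up and down steps have exchanged
  their roles.\<close>
lemma orthogonality_functional_monom_mult_P:
  assumes "normalized_orthogonality_functional (P h k) V"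
  shows "V (monom 1 n * P h k m) = k ^ m * path_weight h k n m"
proof (induction n arbitrary: m)
  case 0
  have "V (P h k m * P h k 0) = 0" if "m \<noteq> 0"
    using assms that unfolding normalized_orthogonality_functional_def by blast
  moreover have "V 1 = 1"
    using assms unfolding normalized_orthogonality_functional_def by blast
  ultimately show ?case
    by (cases "m = 0") simp_all
next
  case (Suc n)
  have add: "V (p + q) = V p + V q" and smult: "V (smult c p) = c * V p" for p q c
    using assms unfolding normalized_orthogonality_functional_def linear_functional_poly_iff
    by blast+
  have x: "monom 1 (Suc n) * q = monom 1 n * pCons 0 q" for q :: "complex poly"
    by (simp add: monom_Suc)
  show ?case
  proof (cases m)
    case 0
    have "pCons 0 (P h k 0) = P h k (Suc 0) + smult (- h) (P h k 0)"
      by (simp add: one_pCons)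
    then have "V (monom 1 (Suc n) * P h k 0)
        = V (monom 1 n * P h k (Suc 0)) - h * V (monom 1 n * P h k 0)"
      by (simp only: x distrib_left mult_smult_right add smult) simp
    then show ?thesis
      unfolding Suc.IH 0 by simp
  next
    case (Suc j)
    have "pCons 0 (P h k (Suc j))
        = P h k (Suc (Suc j)) + smult (- h) (P h k (Suc j)) + smult k (P h k j)"
      by simp
    then have "V (monom 1 (Suc n) * P h k (Suc j))
        = V (monom 1 n * P h k (Suc (Suc j))) - h * V (monom 1 n * P h k (Suc j))
          + k * V (monom 1 n * P h k j)"
      by (simp only: x distrib_left mult_smult_right add smult) simp
    then show ?thesis
      unfolding Suc.IH Suc by (simp add: algebra_simps)
  qed
qed

lemma orthogonality_functional_moment:
  assumes "normalized_orthogonality_functional (P h k) V"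
  shows "V (monom 1 n) = path_weight h k n 0"
  using orthogonality_functional_monom_mult_P[OF assms, of n 0] by simp

lemma orthogonality_functional_unique:
  assumes "normalized_orthogonality_functional (P h k) V"
    and "normalized_orthogonality_functional (P h k) W"
  shows "V = W"
proof
  fix q :: "complex poly"
  have V: "V (p + r) = V p + V r" "V (smult c p) = c * V p"
    and W: "W (p + r) = W p + W r" "W (smult c p) = c * W p" for p r c
    using assms unfolding normalized_orthogonality_functional_def linear_functional_poly_iff
    by blast+
  have zero: "V 0 = W 0"
    using V(2)[of 0 0] W(2)[of 0 0] by simp
  have monom: "V (monom c n) = W (monom c n)" for c n
    using V(2)[of c "monom 1 n"] W(2)[of c "monom 1 n"]
    by (simp add: smult_monom assms[THEN orthogonality_functional_moment])
  have "V (\<Sum>i\<in>A. monom (coeff q i) i) = W (\<Sum>i\<in>A. monom (coeff q i) i)"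
    if "finite A" for A
    using that by (induction A rule: finite_induct) (simp_all add: V(1) W(1) zero monom)
  from this[of "{..degree q}"] show "V q = W q"
    by (simp add: poly_as_sum_of_monoms)
qed

theorem mainTheorem13:
  fixes h k :: complex and n :: nat
  assumes "k \<noteq> 0"
  shows "moment_functional h k (monom 1 n) =
    (\<Sum>p = 1..(n + 2) div 2.
       fact n / (fact p * fact (n + 2 - 2 * p) * fact (p - 1)) *
       (- h) ^ (n + 2 - 2 * p) * k ^ (p - 1))"
proof -
  have "moment_functional h k = basis_coeff h k 0"
    unfolding moment_functional_def
    by (rule the_equality)
      (blast intro: basis_coeff_zero_is_orthogonality_functional orthogonality_functional_unique)+
  then have "normalized_orthogonality_functional (P h k) (moment_functional h k)"
    by (simp add: basis_coeff_zero_is_orthogonality_functional)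
  then have "moment_functional h k (monom 1 n) = path_weight h k n 0"
    by (rule orthogonality_functional_moment)
  then show ?thesis
    by (simp only: path_weight_zero_closed_form)
qed

end
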